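(* Let $\mathbb{K}=(K,+,\cdot,-,\mathsf{s},0,1)$ be a zero-sum-free semiring with monus and support, let $\tau=(\hat R_1,\ldots,\hat R_p)$ be a schema, and let $q$ be an $n$-ary query on $\mathbb{K}$-databases over $\tau$. The following statements are equivalent: 1. There is a $\mathcal{BRA}(\tau)$-expression $E$ of arity $n$ such that $q^{\mathbf I}=E^{\mathbf I}$ for every $\mathbb{K}$-database $\mathbf I$. 2. There is a domain independent $\mathcal{BRC}(\tau)$-formula $\varphi(y_1,\ldots,y_n)$ such that $q^{\mathbf I}=\varphi^{\mathbf A(\mathbf I)}$ for every $\mathbb{K}$-database $\mathbf I$. 3. There is a $\mathcal{BRC}(\tau)$-formula $\varphi(y_1,\ldots,y_n)$ such that $q^{\mathbf I}=\varphi^{\mathbf A(\mathbf I)}$ for every $\mathbb{K}$-database $\mathbf I$.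
   Context: **Semirings.** A semiring $(K,+,\cdot,0,1)$ has $(K,+,0)$ a commutative monoid, $(K,\cdot,1)$ a monoid, $0\neq 1$, $\cdot$ distributing over $+$, and $a\cdot 0=0\cdot a=0$ for all $a$. It is zero-sum-free if $a+b=0$ implies $a=b=0$. Its natural preorder is: $a\preceq b$ iff $a+c=b$ for some $c\in K$; it is naturally ordered if $\preceq$ is a partial order. A semiring with monus is a naturally ordered commutative semiring in which for all $a,b\in K$ there is a $\preceq$-smallest $c$ with $a\preceq b+c$; this $c$ is denoted $a-b$. A support operation is the unary operation with $\mathsf s(a)=1$ if $a\ne0$ and $\mathsf s(0)=0$. A semiring with monus and support is a semiring with monus equipped also with $\mathsf s$. **$\mathbb K$-relations.** $D$ is a fixed denumerable set; $D^0=\{\langle\,\rangle\}$ consists of the empty tuple. An $n$-ary $\mathbb K$-relation ($n\ge0$) is a function $R:D^n\to K$ with $\operatorname{supp}(R)=\{\mathbf t\in D^n: R(\mathbf t)\neq 0\}$ finite. It is a $\mathbb K$-relation on $A\subseteq D$ if $\operatorname{supp}(R)\subseteq A^n$. For $\mathbf t=(d_1,\dots,d_n)$ and a sequence $v=(i_1,\dots,i_k)$ of distinct indices in $\{1,\dots,n\}$, $\mathbf t[v]=(d_{i_1},\dots,d_{i_k})$. An $n$-ary selection condition $\theta$ is built from equalities $x_i=x_j$ and negated equalities $x_i\ne x_j$ ($1\le i,j\le n$) by conjunctions and disjunctions; $P_\theta:D^n\to\{0,1\}$ is $1$ exactly on tuples satisfying $\theta$. **Operations on $\mathbb K$-relations.**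 - Union (same arity): $(R_1\cup R_2)(\mathbf t)=R_1(\mathbf t)+R_2(\mathbf t)$. - Difference (same arity): $(R_1\setminus R_2)(\mathbf t)=R_1(\mathbf t)-R_2(\mathbf t)$. - Cartesian product of an $m$-ary $R_1$ and an $n$-ary $R_2$: the $(m+n)$-ary $(R_1\times R_2)(\mathbf t)=R_1(t_1,\dots,t_m)\cdot R_2(t_{m+1},\dots,t_{m+n})$. - Projection, for $R$ $n$-ary and $v$ a sequence of $k$ distinct indices from $\{1,\dots,n\}$: $\pi_v(R)(\mathbf t)=\sum_{\mathbf w[v]=\mathbf t,\ R(\mathbf w)\ne0}R(\mathbf w)$ for $\mathbf t\in D^k$ (empty sum $=0$); projection on the empty sequence is allowed for every arity: $\pi_{[\,]}(R)(\langle\,\rangle)=\sum_{R(\mathbf t)\neq0}R(\mathbf t)$. - Selection: $\sigma_\theta(R)(\mathbf t)=R(\mathbf t)\cdot P_\theta(\mathbf t)$. - Support: $\operatorname{supp}(R)(\mathbf t)=\mathsf s(R(\mathbf t))$. **Schemas, databases, basic relational algebra.** A schema $\tau=(\hat R_1,\dots,\hat R_p)$ is a finite sequence of relation symbols, $\hat R_i$ having positive arity $r_i$. $\mathcal{BRA}(\tau)$-expressions are built from the symbols $\hat R_i$ (arity $r_i$) by $\cup$, $\setminus$ (same arities), $\times$, $\pi_v$, $\pi_{[\,]}$, $\sigma_\theta$, $\operatorname{supp}$, with the evident arities. A $\mathbb K$-database $\mathbf I=(R_1,\dots,R_p)$ over $\tau$ consists of $\mathbb K$-relations $R_i$ of arity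 $r_i$; all $\mathbb K$-databases are assumed non-trivial, i.e. at least one $R_i$ has non-empty support. $E^{\mathbf I}$ is the $\mathbb K$-relation obtained by interpreting $\hat R_i$ as $R_i$ and evaluating the operations. The active domain $\mathrm{adom}(\mathbf I)$ is the (finite, non-empty) set of elements of $D$ occurring in some tuple of the support of some $R_i$. An $n$-ary query $q$ ($n\ge 0$) assigns to each $\mathbb K$-database $\mathbf I$ an $n$-ary $\mathbb K$-relation $q^{\mathbf I}$ on $\mathrm{adom}(\mathbf I)$. **Basic relational calculus.** $\mathcal{BRC}(\tau)$-formulas are built from atomic formulas $y_i=y_j$ and $\hat R_i(y_1,\dots,y_{r_i})$ (variables from a countable set, possibly repeated) using binary connectives $\wedge,\vee,\mathsf{butnot}$, the unary connective $\nabla$, and $\exists y$ (where $y$ is a free variable of the formula it is applied to); free variables are defined as usual. $\varphi(y_1,\dots,y_n)$ means that $y_1,\dots,y_n$ is a repetition-free list of exactly the free variables of $\varphi$. A $\mathbb K$-structure $\mathbf A=(A,R_1,\dots,R_p)$ has a non-empty universe $A\subseteq D$, assumed finite, and $\mathbb K$-relations $R_i$ on $A$ of arity $r_i$. For an assignment $\alpha$ of elements of $A$ to variables: - $\|x=y\|(\mathbf A,\alpha)=1$ if $\alpha(x)=\alpha(y)$, else $0$; - $\|\hat R_i(z_1,\dots,z_{r_i})\|(\mathbf A,\alpha)=R_i(\alpha(z_1),\dots,\alpha(z_{r_i}))$; - $\wedge,\vee,\mathsf{butnot}$ are interpreted by $\cdot,+,-$ on values, and $\nabla$ by $\mathsf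 s$; - $\|\exists x\,\varphi\|(\mathbf A,\alpha)=\sum_{b\in A}\|\varphi\|(\mathbf A,\alpha[x/b])$. For $\varphi(y_1,\dots,y_n)$, $\varphi^{\mathbf A}:D^n\to K$ is the $\mathbb K$-relation with $\varphi^{\mathbf A}(a_1,\dots,a_n)=\|\varphi\|(\mathbf A,\alpha)$ for any $\alpha$ with $\alpha(y_i)=a_i$ if $(a_1,\dots,a_n)\in A^n$, and $0$ otherwise (for $n=0$: $\varphi^{\mathbf A}(\langle\,\rangle)=\|\varphi\|(\mathbf A,\alpha)$ for any $\alpha$). For a $\mathbb K$-database $\mathbf I=(R_1,\dots,R_p)$, $\mathbf A(\mathbf I)=(\mathrm{adom}(\mathbf I),R_1,\dots,R_p)$. A formula $\varphi$ is domain independent if for every $\mathbb K$-database $\mathbf I=(R_1,\dots,R_p)$ and every $\mathbb K$-structure $\mathbf B=(B,R_1,\dots,R_p)$ with $\mathrm{adom}(\mathbf I)\subseteq B\subseteq D$, $\varphi^{\mathbf B}=\varphi^{\mathbf A(\mathbf I)}$. *)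

theory Defs
  imports Main "HOL-Library.Countable_Set"
begin

section \<open>Semirings with monus and support\<close>

text \<open>The order of \<^class>\<open>canonically_ordered_monoid_add\<close> is the natural preorder, so this class
  says that the natural preorder is a partial order.\<close>

class semiring_monus = comm_semiring_1 + canonically_ordered_monoid_add + minus +
  assumes le_add_monus: "a \<le> b + (a - b)"
    and monus_least: "a \<le> b + c \<Longrightarrow> a - b \<le> c"

definition support_op :: "'k::zero_neq_one \<Rightarrow> 'k" where
  "support_op a = (if a = 0 then 0 else 1)"


section \<open>Relations with values in a semiring\<close>

text \<open>The denumerable set of data values is the whole type \<open>'d\<close>. Tuples are lists, with positions
  counted from 0. A function on \<open>n\<close>-tuples is represented by a function on all lists that is 0 on
  lists of any other length, so that equality of \<open>n\<close>-ary relations is equality of functions.\<close>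

type_synonym ('d, 'k) krel = "'d list \<Rightarrow> 'k"

definition supp :: "('d, 'k::zero) krel \<Rightarrow> 'd list set" where
  "supp R = {t. R t \<noteq> 0}"

definition is_krel :: "nat \<Rightarrow> ('d, 'k::zero) krel \<Rightarrow> bool" where
  "is_krel n R \<longleftrightarrow> finite (supp R) \<and> (\<forall>t. length t \<noteq> n \<longrightarrow> R t = 0)"

definition krel_on :: "'d set \<Rightarrow> ('d, 'k::zero) krel \<Rightarrow> bool" where
  "krel_on A R \<longleftrightarrow> supp R \<subseteq> lists A"

definition tuple_proj :: "'d list \<Rightarrow> nat list \<Rightarrow> 'd list" where
  "tuple_proj t v = map (\<lambda>i. t ! i) v"

datatype selcond =
    SEq nat nat
  | SNeq nat nat
  | SAnd selcond selcond
  | SOr selcond selcond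

primrec selcond_wf :: "nat \<Rightarrow> selcond \<Rightarrow> bool" where
  "selcond_wf n (SEq i j) \<longleftrightarrow> i < n \<and> j < n"
| "selcond_wf n (SNeq i j) \<longleftrightarrow> i < n \<and> j < n"
| "selcond_wf n (SAnd \<theta>1 \<theta>2) \<longleftrightarrow> selcond_wf n \<theta>1 \<and> selcond_wf n \<theta>2"
| "selcond_wf n (SOr \<theta>1 \<theta>2) \<longleftrightarrow> selcond_wf n \<theta>1 \<and> selcond_wf n \<theta>2"

primrec selcond_sat :: "selcond \<Rightarrow> 'd list \<Rightarrow> bool" where
  "selcond_sat (SEq i j) t \<longleftrightarrow> t ! i = t ! j"
| "selcond_sat (SNeq i j) t \<longleftrightarrow> t ! i \<noteq> t ! j"
| "selcond_sat (SAnd \<theta>1 \<theta>2) t \<longleftrightarrow> selcond_sat \<theta>1 t \<and> selcond_sat \<theta>2 t"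
| "selcond_sat (SOr \<theta>1 \<theta>2) t \<longleftrightarrow> selcond_sat \<theta>1 t \<or> selcond_sat \<theta>2 t"

text \<open>In each of the following operations no guard on the length of the argument tuple is needed:
  on relations of the intended arities the result is 0 on tuples of the wrong length.\<close>

definition kr_union :: "('d, 'k::semiring_monus) krel \<Rightarrow> ('d, 'k) krel \<Rightarrow> ('d, 'k) krel" where
  "kr_union R1 R2 = (\<lambda>t. R1 t + R2 t)"

definition kr_diff :: "('d, 'k::semiring_monus) krel \<Rightarrow> ('d, 'k) krel \<Rightarrow> ('d, 'k) krel" where
  "kr_diff R1 R2 = (\<lambda>t. R1 t - R2 t)"

text \<open>The first argument of \<open>kr_times\<close> is the arity of \<open>R1\<close>.\<close>

definition kr_times ::
  "nat \<Rightarrow> ('d, 'k::semiring_monus) krel \<Rightarrow> ('d, 'k) krel \<Rightarrow> ('d, 'k) krel" where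
  "kr_times m R1 R2 = (\<lambda>t. R1 (take m t) * R2 (drop m t))"

definition kr_proj :: "nat list \<Rightarrow> ('d, 'k::semiring_monus) krel \<Rightarrow> ('d, 'k) krel" where
  "kr_proj v R = (\<lambda>t. \<Sum>w | tuple_proj w v = t \<and> R w \<noteq> 0. R w)"

definition kr_sel :: "selcond \<Rightarrow> ('d, 'k::semiring_monus) krel \<Rightarrow> ('d, 'k) krel" where
  "kr_sel \<theta> R = (\<lambda>t. R t * (if selcond_sat \<theta> t then 1 else 0))"

definition kr_supp :: "('d, 'k::semiring_monus) krel \<Rightarrow> ('d, 'k) krel" where
  "kr_supp R = (\<lambda>t. support_op (R t))"


section \<open>Schemas, databases, queries\<close>

text \<open>A schema is the list of the arities of its relation symbols. It must have at least one symbol: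
  over an empty schema there is no non-trivial database.\<close>

definition is_schema :: "nat list \<Rightarrow> bool" where
  "is_schema \<tau> \<longleftrightarrow> \<tau> \<noteq> [] \<and> (\<forall>r \<in> set \<tau>. 0 < r)"

type_synonym ('d, 'k) db = "('d, 'k) krel list"

definition is_database :: "nat list \<Rightarrow> ('d, 'k::zero) db \<Rightarrow> bool" where
  "is_database \<tau> I \<longleftrightarrow>
     length I = length \<tau> \<and> (\<forall>i < length \<tau>. is_krel (\<tau> ! i) (I ! i)) \<and> (\<exists>R \<in> set I. supp R \<noteq> {})"

definition adom :: "('d, 'k::zero) db \<Rightarrow> 'd set" where
  "adom I = (\<Union>R \<in> set I. \<Union>t \<in> supp R. set t)"

text \<open>Only the values of \<open>q\<close> on databases over \<open>\<tau>\<close> matter.\<close>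

definition is_query :: "nat list \<Rightarrow> nat \<Rightarrow> (('d, 'k::zero) db \<Rightarrow> ('d, 'k) krel) \<Rightarrow> bool" where
  "is_query \<tau> n q \<longleftrightarrow> (\<forall>I. is_database \<tau> I \<longrightarrow> is_krel n (q I) \<and> krel_on (adom I) (q I))"


section \<open>Basic relational algebra\<close>

datatype bra =
    Sym nat
  | Union bra bra
  | Diff bra bra
  | Times bra bra
  | Proj "nat list" bra
  | Sel selcond bra
  | Supp bra

primrec bra_arity :: "nat list \<Rightarrow> bra \<Rightarrow> nat" where
  "bra_arity \<tau> (Sym i) = \<tau> ! i"
| "bra_arity \<tau> (Union E1 E2) = bra_arity \<tau> E1"
| "bra_arity \<tau> (Diff E1 E2) = bra_arity \<tau> E1"
| "bra_arity \<tau> (Times E1 E2) = bra_arity \<tau> E1 + bra_arity \<tau> E2"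
| "bra_arity \<tau> (Proj v E) = length v"
| "bra_arity \<tau> (Sel \<theta> E) = bra_arity \<tau> E"
| "bra_arity \<tau> (Supp E) = bra_arity \<tau> E"

text \<open>The index sequence of a projection may be empty, for every arity of its argument.\<close>

primrec bra_wf :: "nat list \<Rightarrow> bra \<Rightarrow> bool" where
  "bra_wf \<tau> (Sym i) \<longleftrightarrow> i < length \<tau>"
| "bra_wf \<tau> (Union E1 E2) \<longleftrightarrow> bra_wf \<tau> E1 \<and> bra_wf \<tau> E2 \<and> bra_arity \<tau> E1 = bra_arity \<tau> E2"
| "bra_wf \<tau> (Diff E1 E2) \<longleftrightarrow> bra_wf \<tau> E1 \<and> bra_wf \<tau> E2 \<and> bra_arity \<tau> E1 = bra_arity \<tau> E2"
| "bra_wf \<tau> (Times E1 E2) \<longleftrightarrow> bra_wf \<tau> E1 \<and> bra_wf \<tau> E2"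
| "bra_wf \<tau> (Proj v E) \<longleftrightarrow> bra_wf \<tau> E \<and> distinct v \<and> set v \<subseteq> {..<bra_arity \<tau> E}"
| "bra_wf \<tau> (Sel \<theta> E) \<longleftrightarrow> bra_wf \<tau> E \<and> selcond_wf (bra_arity \<tau> E) \<theta>"
| "bra_wf \<tau> (Supp E) \<longleftrightarrow> bra_wf \<tau> E"

primrec bra_eval :: "nat list \<Rightarrow> ('d, 'k::semiring_monus) db \<Rightarrow> bra \<Rightarrow> ('d, 'k) krel" where
  "bra_eval \<tau> I (Sym i) = I ! i"
| "bra_eval \<tau> I (Union E1 E2) = kr_union (bra_eval \<tau> I E1) (bra_eval \<tau> I E2)"
| "bra_eval \<tau> I (Diff E1 E2) = kr_diff (bra_eval \<tau> I E1) (bra_eval \<tau> I E2)"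
| "bra_eval \<tau> I (Times E1 E2) = kr_times (bra_arity \<tau> E1) (bra_eval \<tau> I E1) (bra_eval \<tau> I E2)"
| "bra_eval \<tau> I (Proj v E) = kr_proj v (bra_eval \<tau> I E)"
| "bra_eval \<tau> I (Sel \<theta> E) = kr_sel \<theta> (bra_eval \<tau> I E)"
| "bra_eval \<tau> I (Supp E) = kr_supp (bra_eval \<tau> I E)"


section \<open>Basic relational calculus\<close>

datatype brc =
    FEq nat nat
  | FSym nat "nat list"
  | FAnd brc brc
  | FOr brc brc
  | FButnot brc brc
  | FNabla brc
  | FEx nat brc

primrec fv :: "brc \<Rightarrow> nat set" where
  "fv (FEq x y) = {x, y}"
| "fv (FSym i zs) = set zs"
| "fv (FAnd \<phi> \<psi>) = fv \<phi> \<union> fv \<psi>"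
| "fv (FOr \<phi> \<psi>) = fv \<phi> \<union> fv \<psi>"
| "fv (FButnot \<phi> \<psi>) = fv \<phi> \<union> fv \<psi>"
| "fv (FNabla \<phi>) = fv \<phi>"
| "fv (FEx y \<phi>) = fv \<phi> - {y}"

primrec brc_wf :: "nat list \<Rightarrow> brc \<Rightarrow> bool" where
  "brc_wf \<tau> (FEq x y) \<longleftrightarrow> True"
| "brc_wf \<tau> (FSym i zs) \<longleftrightarrow> i < length \<tau> \<and> length zs = \<tau> ! i"
| "brc_wf \<tau> (FAnd \<phi> \<psi>) \<longleftrightarrow> brc_wf \<tau> \<phi> \<and> brc_wf \<tau> \<psi>"
| "brc_wf \<tau> (FOr \<phi> \<psi>) \<longleftrightarrow> brc_wf \<tau> \<phi> \<and> brc_wf \<tau> \<psi>"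
| "brc_wf \<tau> (FButnot \<phi> \<psi>) \<longleftrightarrow> brc_wf \<tau> \<phi> \<and> brc_wf \<tau> \<psi>"
| "brc_wf \<tau> (FNabla \<phi>) \<longleftrightarrow> brc_wf \<tau> \<phi>"
| "brc_wf \<tau> (FEx y \<phi>) \<longleftrightarrow> brc_wf \<tau> \<phi> \<and> y \<in> fv \<phi>"

definition is_structure :: "nat list \<Rightarrow> 'd set \<Rightarrow> ('d, 'k::zero) db \<Rightarrow> bool" where
  "is_structure \<tau> A Rs \<longleftrightarrow>
     A \<noteq> {} \<and> finite A \<and> length Rs = length \<tau> \<and>
     (\<forall>i < length \<tau>. is_krel (\<tau> ! i) (Rs ! i) \<and> krel_on A (Rs ! i))"

primrec brc_val ::
  "'d set \<Rightarrow> ('d, 'k::semiring_monus) db \<Rightarrow> brc \<Rightarrow> (nat \<Rightarrow> 'd) \<Rightarrow> 'k" where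
  "brc_val A Rs (FEq x y) \<alpha> = (if \<alpha> x = \<alpha> y then 1 else 0)"
| "brc_val A Rs (FSym i zs) \<alpha> = (Rs ! i) (map \<alpha> zs)"
| "brc_val A Rs (FAnd \<phi> \<psi>) \<alpha> = brc_val A Rs \<phi> \<alpha> * brc_val A Rs \<psi> \<alpha>"
| "brc_val A Rs (FOr \<phi> \<psi>) \<alpha> = brc_val A Rs \<phi> \<alpha> + brc_val A Rs \<psi> \<alpha>"
| "brc_val A Rs (FButnot \<phi> \<psi>) \<alpha> = brc_val A Rs \<phi> \<alpha> - brc_val A Rs \<psi> \<alpha>"
| "brc_val A Rs (FNabla \<phi>) \<alpha> = support_op (brc_val A Rs \<phi> \<alpha>)"
| "brc_val A Rs (FEx x \<phi>) \<alpha> = (\<Sum>b \<in> A. brc_val A Rs \<phi> (\<alpha>(x := b)))"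

lemma brc_val_cong:
  "(\<And>x. x \<in> fv \<phi> \<Longrightarrow> \<alpha> x = \<beta> x) \<Longrightarrow> brc_val A Rs \<phi> \<alpha> = brc_val A Rs \<phi> \<beta>"
proof (induction \<phi> arbitrary: \<alpha> \<beta>)
  case (FSym i zs)
  then have "map \<alpha> zs = map \<beta> zs" by simp
  then show ?case by (simp only: brc_val.simps)
next
  case (FAnd \<phi> \<psi>)
  then show ?case by (metis UnCI brc_val.simps(3) fv.simps(3))
next
  case (FOr \<phi> \<psi>)
  then show ?case by (metis UnCI brc_val.simps(4) fv.simps(4))
next
  case (FButnot \<phi> \<psi>)
  then show ?case by (metis UnCI brc_val.simps(5) fv.simps(5))
next
  case (FNabla \<phi>)
  then show ?case by (metis brc_val.simps(6) fv.simps(6))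
next
  case (FEx x \<phi>)
  have "brc_val A Rs \<phi> (\<alpha>(x := b)) = brc_val A Rs \<phi> (\<beta>(x := b))" for b
    by (rule FEx.IH) (use FEx.prems in auto)
  then show ?case by simp
qed simp

definition lists_fv :: "nat list \<Rightarrow> brc \<Rightarrow> bool" where
  "lists_fv ys \<phi> \<longleftrightarrow> distinct ys \<and> set ys = fv \<phi>"

text \<open>By \<open>brc_val_cong\<close> the choice of the assignment does not matter when \<open>lists_fv ys \<phi>\<close>.\<close>

definition brc_rel ::
  "'d set \<Rightarrow> ('d, 'k::semiring_monus) db \<Rightarrow> brc \<Rightarrow> nat list \<Rightarrow> ('d, 'k) krel" where
  "brc_rel A Rs \<phi> ys = (\<lambda>t.
     if length t = length ys \<and> set t \<subseteq> A
     then brc_val A Rs \<phi> (SOME \<alpha>. range \<alpha> \<subseteq> A \<and> map \<alpha> ys = t)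
     else 0)"

text \<open>The type arguments fix the data values and the semiring over which databases range.\<close>

definition domain_independent ::
  "'d itself \<Rightarrow> 'k::semiring_monus itself \<Rightarrow> nat list \<Rightarrow> brc \<Rightarrow> nat list \<Rightarrow> bool" where
  "domain_independent _ _ \<tau> \<phi> ys \<longleftrightarrow>
     (\<forall>(I :: ('d, 'k) db) B. is_database \<tau> I \<longrightarrow> is_structure \<tau> B I \<longrightarrow> adom I \<subseteq> B \<longrightarrow>
        brc_rel B I \<phi> ys = brc_rel (adom I) I \<phi> ys)"

end

theory Submission
  imports Defs
begin

text \<open>
  An algebra expression is translated relative to a list of distinct variables naming its
  columns. Its value vanishes outside the active domain, so the quantifiers that render
  a projection sum the same nonzero terms over every larger universe: the formula is domain
  independent.

  A calculus formula is translated relative to an arity \<open>k\<close> and a map \<open>f\<close> from variables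
  to columns; a quantifier adds a column, which is then projected away. Hence no column is ever
  summed that does not stem from a quantifier, and multiplicities come out right even for sentences.
  Conjunction is a product followed by an equijoin, and the relation that is 1 exactly on the
  \<open>k\<close>-tuples over the active domain is definable because the semiring is zero-sum-free
  and has the support operation.
\<close>

section \<open>Semirings with monus and support\<close>

lemma monus_zero_left [simp]: "0 - (a::'k::semiring_monus) = 0"
  using monus_least[of 0 a 0] by simp

lemma monus_self [simp]: "a - (a::'k::semiring_monus) = 0"
  using monus_least[of a a 0] by simp

lemma monus_zero_right [simp]: "a - (0::'k::semiring_monus) = a"
  using monus_least[of a 0 a] le_add_monus[of a 0] by (simp add: antisym)

lemma support_op_eq_0_iff [simp]: "support_op a = 0 \<longleftrightarrow> a = 0"
  by (simp add: support_op_def)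

section \<open>Arity and active domain\<close>

text \<open>Finiteness of the support is left out on purpose: it follows as soon as \<open>A\<close>
  is finite.\<close>

definition krel_over :: "nat \<Rightarrow> 'd set \<Rightarrow> ('d, 'k::zero) krel \<Rightarrow> bool" where
  "krel_over n A R \<longleftrightarrow> (\<forall>t. R t \<noteq> 0 \<longrightarrow> length t = n \<and> set t \<subseteq> A)"

lemma krel_overD:
  assumes "krel_over n A R" "R t \<noteq> 0"
  shows "length t = n" "set t \<subseteq> A"
  using assms by (auto simp: krel_over_def)

lemma finite_krel_over:
  assumes "krel_over n A R" "finite A"
  shows "finite {t. R t \<noteq> 0}"
  by (rule finite_subset[OF _ finite_lists_length_eq[OF assms(2), of n]])
    (use assms(1) in \<open>auto simp: krel_over_def\<close>)

lemma finite_adom: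
  assumes "is_database \<tau> I"
  shows "finite (adom I)"
proof -
  have "finite (supp R)" if "R \<in> set I" for R
    using assms that by (auto simp: is_database_def is_krel_def in_set_conv_nth)
  then show ?thesis by (auto simp: adom_def)
qed

text \<open>A support could be non-empty and yet hold only the empty tuple; positive arities rule
  this out.\<close>

lemma adom_nonempty:
  assumes "is_schema \<tau>" "is_database \<tau> I"
  shows "adom I \<noteq> {}"
proof -
  obtain i t where i: "i < length \<tau>" "t \<in> supp (I ! i)"
    using assms(2) by (auto simp: is_database_def in_set_conv_nth)
  then have "length t = \<tau> ! i" "I ! i \<in> set I"
    using assms(2) by (auto simp: is_database_def is_krel_def supp_def)
  moreover have "0 < \<tau> ! i" using assms(1) i by (simp add: is_schema_def)
  ultimately have "t \<noteq> []" "set t \<subseteq> adom I" using i by (auto simp: adom_def)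
  then show ?thesis by (cases t) auto
qed

lemma krel_over_database:
  assumes "is_database \<tau> I" "i < length \<tau>"
  shows "krel_over (\<tau> ! i) (adom I) (I ! i)"
  using assms unfolding krel_over_def is_database_def is_krel_def adom_def supp_def
  by (fastforce simp: in_set_conv_nth)

lemma kr_proj_nonzeroD:
  assumes "kr_proj v R t \<noteq> 0"
  obtains w where "t = tuple_proj w v" "R w \<noteq> 0"
proof -
  have "{w. tuple_proj w v = t \<and> R w \<noteq> 0} \<noteq> {}"
    using assms unfolding kr_proj_def by (metis (no_types, lifting) sum.empty)
  then show thesis using that by auto
qed

text \<open>No operation creates a nonzero value from zeros alone: \<open>0 - a = 0\<close>, a
  nonzero product has nonzero factors, and a nonzero projection has a nonzero term. This licenses
  the missing length guards and confines every value to the active domain.\<close>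

lemma krel_over_bra_eval:
  assumes "is_database \<tau> I" "bra_wf \<tau> E"
  shows "krel_over (bra_arity \<tau> E) (adom I) (bra_eval \<tau> I E)"
  using assms(2)
proof (induction E)
  case (Sym i)
  then show ?case using krel_over_database[OF assms(1)] by simp
next
  case (Union E1 E2)
  then show ?case by (auto simp: krel_over_def kr_union_def)
next
  case (Diff E1 E2)
  show ?case unfolding krel_over_def
  proof (intro allI impI)
    fix t assume "bra_eval \<tau> I (Diff E1 E2) t \<noteq> 0"
    then have "bra_eval \<tau> I E1 t \<noteq> 0" by (auto simp: kr_diff_def)
    then show "length t = bra_arity \<tau> (Diff E1 E2) \<and> set t \<subseteq> adom I"
      using Diff by (auto simp: krel_over_def)
  qed
next
  case (Times E1 E2)
  show ?case unfolding krel_over_def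
  proof (intro allI impI)
    fix t
    let ?m = "bra_arity \<tau> E1"
    assume "bra_eval \<tau> I (Times E1 E2) t \<noteq> 0"
    then have "bra_eval \<tau> I E1 (take ?m t) \<noteq> 0" "bra_eval \<tau> I E2 (drop ?m t) \<noteq> 0"
      by (auto simp: kr_times_def)
    then have "length (take ?m t) = ?m" "length (drop ?m t) = bra_arity \<tau> E2"
      "set (take ?m t) \<union> set (drop ?m t) \<subseteq> adom I"
      using Times by (auto simp: krel_over_def)
    then show "length t = bra_arity \<tau> (Times E1 E2) \<and> set t \<subseteq> adom I"
      by (auto simp flip: set_append)
  qed
next
  case (Proj v E)
  show ?case unfolding krel_over_def
  proof (intro allI impI)
    fix t
    assume "bra_eval \<tau> I (Proj v E) t \<noteq> 0"
    then obtain w where w: "t = tuple_proj w v" "bra_eval \<tau> I E w \<noteq> 0"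
      by (auto elim: kr_proj_nonzeroD)
    then have "length w = bra_arity \<tau> E" "set w \<subseteq> adom I"
      using Proj by (auto simp: krel_over_def)
    then show "length t = bra_arity \<tau> (Proj v E) \<and> set t \<subseteq> adom I"
      using w(1) Proj.prems by (auto simp: tuple_proj_def intro!: subsetD[OF _ nth_mem])
  qed
next
  case (Sel \<theta> E)
  then show ?case by (auto simp: krel_over_def kr_sel_def)
next
  case (Supp E)
  then show ?case by (auto simp: krel_over_def kr_supp_def)
qed

lemma brc_rel_eq_brc_val:
  assumes "A \<noteq> {}" "lists_fv ys \<phi>" "map \<alpha> ys = t" "set t \<subseteq> A"
  shows "brc_rel A Rs \<phi> ys t = brc_val A Rs \<phi> \<alpha>"
proof -
  obtain a where a: "a \<in> A" using assms(1) by auto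
  define \<beta> where "\<beta> = (SOME \<alpha>. range \<alpha> \<subseteq> A \<and> map \<alpha> ys = t)"
  \<comment> \<open>\<open>\<alpha>\<close> may leave \<open>A\<close> off \<open>ys\<close>.
    Redirecting those variables to \<open>a\<close> shows that the choice in \<open>brc_rel\<close>
    has a witness.\<close>
  have "range (\<lambda>x. if x \<in> set ys then \<alpha> x else a) \<subseteq> A \<and>
      map (\<lambda>x. if x \<in> set ys then \<alpha> x else a) ys = t"
    using a assms(3,4) by auto
  then have "range \<beta> \<subseteq> A \<and> map \<beta> ys = t" unfolding \<beta>_def by (rule someI[where P = "\<lambda>\<alpha>. range \<alpha> \<subseteq> A \<and> map \<alpha> ys = t"])
  then have "map \<beta> ys = map \<alpha> ys" using assms(3) by simp
  then have "brc_val A Rs \<phi> \<beta> = brc_val A Rs \<phi> \<alpha>"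
    using assms(2) by (intro brc_val_cong) (auto simp: lists_fv_def)
  moreover have "length t = length ys" using assms(3) by auto
  ultimately show ?thesis using assms(4) by (simp add: brc_rel_def \<beta>_def)
qed

section \<open>From the algebra to the calculus\<close>

text \<open>Disjunction needs \<open>FNabla\<close> because \<open>1 + 1\<close> need not be \<open>1\<close>.\<close>

primrec cond_formula :: "nat list \<Rightarrow> selcond \<Rightarrow> brc" where
  "cond_formula ys (SEq i j) = FEq (ys ! i) (ys ! j)"
| "cond_formula ys (SNeq i j) =
     FButnot (FAnd (FEq (ys ! i) (ys ! i)) (FEq (ys ! j) (ys ! j))) (FEq (ys ! i) (ys ! j))"
| "cond_formula ys (SAnd \<theta>1 \<theta>2) = FAnd (cond_formula ys \<theta>1) (cond_formula ys \<theta>2)"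
| "cond_formula ys (SOr \<theta>1 \<theta>2) = FNabla (FOr (cond_formula ys \<theta>1) (cond_formula ys \<theta>2))"

lemma cond_formula_wf: "brc_wf \<tau> (cond_formula ys \<theta>)"
  by (induction \<theta>) auto

lemma fv_cond_formula: "selcond_wf (length ys) \<theta> \<Longrightarrow> fv (cond_formula ys \<theta>) \<subseteq> set ys"
  by (induction \<theta>) auto

text \<open>A negated equality is a constant 1 from which the equality is subtracted:
  \<open>1 - 1 = 0\<close> and \<open>1 - 0 = 1\<close>.\<close>

lemma brc_val_cond_formula:
  "selcond_wf (length ys) \<theta> \<Longrightarrow>
    brc_val B I (cond_formula ys \<theta>) \<alpha> = (if selcond_sat \<theta> (map \<alpha> ys) then 1 else 0)"
  by (induction \<theta>) (auto simp: support_op_def)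

section \<open>Blocks of quantifiers as single sums\<close>

definition variants :: "'d set \<Rightarrow> nat set \<Rightarrow> (nat \<Rightarrow> 'd) \<Rightarrow> (nat \<Rightarrow> 'd) set" where
  "variants B Z \<alpha> = {\<beta>. (\<forall>x. x \<notin> Z \<longrightarrow> \<beta> x = \<alpha> x) \<and> (\<forall>x\<in>Z. \<beta> x \<in> B)}"

lemma variants_empty: "variants B {} \<alpha> = {\<alpha>}"
  by (auto simp: variants_def)

lemma variants_insert:
  assumes "z \<notin> Z"
  shows "variants B (insert z Z) \<alpha> = (\<Union>b\<in>B. variants B Z (\<alpha>(z := b)))"
  using assms by (auto simp: variants_def)

lemma finite_variants:
  assumes "finite Z" "finite B"
  shows "finite (variants B Z \<alpha>)"
  using assms by (induction Z arbitrary: \<alpha>) (simp_all add: variants_empty variants_insert)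

text \<open>The variants split into disjoint classes by their value at the first quantified
  variable, so the nested sums merge into one.\<close>

lemma brc_val_foldr_FEx:
  assumes "distinct zs" "finite B"
  shows "brc_val B I (foldr FEx zs \<phi>) \<alpha> = (\<Sum>\<beta>\<in>variants B (set zs) \<alpha>. brc_val B I \<phi> \<beta>)"
  using assms(1)
proof (induction zs arbitrary: \<alpha>)
  case Nil
  then show ?case by (simp add: variants_empty)
next
  case (Cons z zs)
  have "(\<Sum>\<beta>\<in>variants B (set (z # zs)) \<alpha>. brc_val B I \<phi> \<beta>) =
      (\<Sum>b\<in>B. \<Sum>\<beta>\<in>variants B (set zs) (\<alpha>(z := b)). brc_val B I \<phi> \<beta>)"
  proof -
    have "variants B (set zs) (\<alpha>(z := b)) \<inter> variants B (set zs) (\<alpha>(z := c)) = {}"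
      if "b \<noteq> c" for b c
      using Cons.prems that by (auto simp: variants_def)
    then show ?thesis
      using Cons.prems assms(2)
      by (simp add: variants_insert sum.UNION_disjoint finite_variants)
  qed
  then show ?case using Cons by simp
qed

section \<open>Column names for projections\<close>

text \<open>Names for the columns of the argument of \<open>Proj v\<close> when \<open>ys\<close> names those of the result.\<close>

definition col_names :: "nat list \<Rightarrow> nat list \<Rightarrow> nat \<Rightarrow> nat list" where
  "col_names v ys m =
     map (\<lambda>i. case map_of (zip v ys) i of Some y \<Rightarrow> y | None \<Rightarrow> Suc (sum_list ys) + i) [0..<m]"

lemma length_col_names [simp]: "length (col_names v ys m) = m"
  by (simp add: col_names_def)

lemma col_names_nth_index:
  assumes "distinct v" "length ys = length v" "j < length v" "v ! j < m"
  shows "col_names v ys m ! (v ! j) = ys ! j"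
  using assms by (simp add: col_names_def map_of_zip_nth)

lemma col_names_nth_fresh:
  assumes "length ys = length v" "i < m" "i \<notin> set v"
  shows "col_names v ys m ! i = Suc (sum_list ys) + i"
proof -
  have "map_of (zip v ys) i = None" using assms by (simp add: map_of_zip_is_None)
  then show ?thesis using assms by (simp add: col_names_def del: map_of_zip_is_None)
qed

text \<open>Every entry of a list of naturals is at most the sum of the list.\<close>

lemma fresh_not_in: "Suc (sum_list ys) + i \<notin> set (ys :: nat list)"
  using member_le_sum_list[of "Suc (sum_list ys) + i" ys] by auto

text \<open>Hence removing the names in \<open>ys\<close> leaves exactly the columns that the
  projection sums away.\<close>

lemma col_names_in_iff:
  assumes "distinct v" "length ys = length v" "set v \<subseteq> {..<m}" "i < m"
  shows "col_names v ys m ! i \<in> set ys \<longleftrightarrow> i \<in> set v"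
proof (cases "i \<in> set v")
  case True
  then obtain j where "j < length v" "i = v ! j" by (auto simp: in_set_conv_nth)
  then show ?thesis using col_names_nth_index[OF assms(1,2)] assms by auto
next
  case False
  then show ?thesis using col_names_nth_fresh[OF assms(2,4)] fresh_not_in[of ys i] by simp
qed

text \<open>Two kept columns differ since \<open>ys\<close> is distinct, two dropped ones by the
  offset \<open>i\<close>, and a kept and a dropped one since fresh names lie outside
  \<open>ys\<close>.\<close>

lemma distinct_col_names:
  assumes "distinct v" "distinct ys" "length ys = length v" "set v \<subseteq> {..<m}"
  shows "distinct (col_names v ys m)"
  unfolding distinct_conv_nth length_col_names
proof (intro allI impI)
  fix i i' assume i: "i < m" "i' < m" "i \<noteq> i'"
  consider "i \<in> set v" "i' \<in> set v" | "i \<in> set v \<longleftrightarrow> i' \<notin> set v" | "i \<notin> set v" "i' \<notin> set v"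
    by auto
  then show "col_names v ys m ! i \<noteq> col_names v ys m ! i'"
  proof cases
    case 1
    then obtain j j' where "j < length v" "i = v ! j" "j' < length v" "i' = v ! j'"
      by (auto simp: in_set_conv_nth)
    then show ?thesis
      using i assms col_names_nth_index[OF assms(1,3)] by (auto simp: nth_eq_iff_index_eq)
  next
    case 2
    then show ?thesis using i col_names_in_iff[OF assms(1,3,4)] by metis
  next
    case 3
    then show ?thesis using i by (simp add: col_names_nth_fresh[OF assms(3)])
  qed
qed

lemma set_subset_col_names:
  assumes "distinct v" "length ys = length v" "set v \<subseteq> {..<m}"
  shows "set ys \<subseteq> set (col_names v ys m)"
proof
  fix y assume "y \<in> set ys"
  then obtain j where j: "j < length v" "y = ys ! j" using assms(2) by (auto simp: in_set_conv_nth)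
  then have "v ! j < m" using assms(3) nth_mem by blast
  then show "y \<in> set (col_names v ys m)"
    using col_names_nth_index[OF assms(1,2) j(1)] j(2) by (metis length_col_names nth_mem)
qed

section \<open>The translation of expressions\<close>

text \<open>In \<open>Times\<close> each factor gets its own part of \<open>ys\<close>. A name that
  is fresh for one factor may occur free in the other; this is harmless, as it is bound where it was
  introduced.\<close>

primrec calc_of :: "nat list \<Rightarrow> bra \<Rightarrow> nat list \<Rightarrow> brc" where
  "calc_of \<tau> (Sym i) ys = FSym i ys"
| "calc_of \<tau> (Union E1 E2) ys = FOr (calc_of \<tau> E1 ys) (calc_of \<tau> E2 ys)"
| "calc_of \<tau> (Diff E1 E2) ys = FButnot (calc_of \<tau> E1 ys) (calc_of \<tau> E2 ys)"
| "calc_of \<tau> (Times E1 E2) ys =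
     FAnd (calc_of \<tau> E1 (take (bra_arity \<tau> E1) ys)) (calc_of \<tau> E2 (drop (bra_arity \<tau> E1) ys))"
| "calc_of \<tau> (Proj v E) ys =
     (let ws = col_names v ys (bra_arity \<tau> E)
      in foldr FEx (filter (\<lambda>x. x \<notin> set ys) ws) (calc_of \<tau> E ws))"
| "calc_of \<tau> (Sel \<theta> E) ys = FAnd (calc_of \<tau> E ys) (cond_formula ys \<theta>)"
| "calc_of \<tau> (Supp E) ys = FNabla (calc_of \<tau> E ys)"

lemma fv_foldr_FEx: "fv (foldr FEx zs \<phi>) = fv \<phi> - set zs"
  by (induction zs) auto

lemma brc_wf_foldr_FEx:
  assumes "distinct zs" "set zs \<subseteq> fv \<phi>" "brc_wf \<tau> \<phi>"
  shows "brc_wf \<tau> (foldr FEx zs \<phi>)"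
  using assms by (induction zs) (auto simp: fv_foldr_FEx)

text \<open>The free variables must be all of \<open>set ys\<close>, not just some of them:
  \<open>FEx\<close> is allowed only on a free variable, so each dropped column has to occur free in
  the formula for the argument.\<close>

lemma calc_of_wf:
  assumes "bra_wf \<tau> E" "distinct ys" "length ys = bra_arity \<tau> E"
  shows "brc_wf \<tau> (calc_of \<tau> E ys) \<and> fv (calc_of \<tau> E ys) = set ys"
  using assms
proof (induction E arbitrary: ys)
  case (Times E1 E2)
  then show ?case by (simp flip: set_append)
next
  case (Proj v E)
  define ws where "ws = col_names v ys (bra_arity \<tau> E)"
  have v: "distinct v" "length ys = length v" "set v \<subseteq> {..<bra_arity \<tau> E}"
    using Proj.prems by auto
  have d: "distinct ws" and s: "set ys \<subseteq> set ws"
    using distinct_col_names set_subset_col_names v Proj.prems(2) by (auto simp: ws_def)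
  have "brc_wf \<tau> (calc_of \<tau> E ws) \<and> fv (calc_of \<tau> E ws) = set ws"
    by (rule Proj.IH) (use Proj.prems d in \<open>auto simp: ws_def\<close>)
  then show ?case using d s
    by (auto simp: Let_def fv_foldr_FEx simp flip: ws_def intro!: brc_wf_foldr_FEx)
next
  case (Sel \<theta> E)
  then show ?case using fv_cond_formula[of ys \<theta>] by (auto simp: cond_formula_wf)
qed auto

text \<open>Reading off the columns maps the variants injectively to tuples. The image covers every
  tuple in the support of \<open>R\<close> that projects to \<open>map \<alpha> ys\<close>, and its
  other tuples contribute 0.\<close>

lemma kr_proj_eq_sum_variants:
  fixes R :: "('d, 'k::semiring_monus) krel"
  assumes "krel_over m B R" "finite B" "distinct v" "set v \<subseteq> {..<m}"
    and "distinct ys" "length ys = length v"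
  defines "ws \<equiv> col_names v ys m"
  shows "kr_proj v R (map \<alpha> ys) =
    (\<Sum>\<beta>\<in>variants B (set (filter (\<lambda>x. x \<notin> set ys) ws)) \<alpha>. R (map \<beta> ws))"
proof -
  let ?Z = "set (filter (\<lambda>x. x \<notin> set ys) ws)"
  let ?V = "variants B ?Z \<alpha>"
  let ?W = "{w. tuple_proj w v = map \<alpha> ys \<and> R w \<noteq> 0}"
  have len: "length ws = m" by (simp add: ws_def)
  have d: "distinct ws" unfolding ws_def using assms(3-6) by (intro distinct_col_names)
  have col: "ws ! (v ! j) = ys ! j" "v ! j < m" if "j < length v" for j
    using col_names_nth_index[OF assms(3,6) that] assms(4) that nth_mem
    by (auto simp: ws_def)
  have inj: "inj_on (\<lambda>\<beta>. map \<beta> ws) ?V"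
  proof (rule inj_onI, rule ext)
    fix \<beta> \<gamma> x
    assume "\<beta> \<in> ?V" "\<gamma> \<in> ?V" "map \<beta> ws = map \<gamma> ws"
    then show "\<beta> x = \<gamma> x" by (cases "x \<in> ?Z") (auto simp: variants_def)
  qed
  have proj: "tuple_proj (map \<beta> ws) v = map \<alpha> ys" if "\<beta> \<in> ?V" for \<beta>
  proof (rule nth_equalityI)
    fix j assume "j < length (tuple_proj (map \<beta> ws) v)"
    then have j: "j < length v" by (simp add: tuple_proj_def)
    then have "\<beta> (ys ! j) = \<alpha> (ys ! j)" using that assms(6) by (auto simp: variants_def)
    then show "tuple_proj (map \<beta> ws) v ! j = map \<alpha> ys ! j"
      using j col[OF j] assms(6) len by (simp add: tuple_proj_def)
  qed (simp add: tuple_proj_def assms(6))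
  have W: "?W \<subseteq> (\<lambda>\<beta>. map \<beta> ws) ` ?V"
  proof
    fix w assume "w \<in> ?W"
    then have w: "tuple_proj w v = map \<alpha> ys" "R w \<noteq> 0" by auto
    have lw: "length w = m" and sw: "set w \<subseteq> B" using krel_overD[OF assms(1) w(2)] by auto
    \<comment> \<open>The preimage of \<open>w\<close> takes the dropped columns from
      \<open>w\<close>; at the kept ones \<open>\<alpha>\<close> agrees with \<open>w\<close>
      already, because \<open>w\<close> projects to \<open>map \<alpha> ys\<close>.\<close>
    define \<beta> where "\<beta> x = (if x \<in> ?Z then the (map_of (zip ws w) x) else \<alpha> x)" for x
    have fresh: "the (map_of (zip ws w) (ws ! i)) = w ! i" if "i < m" for i
      using map_of_zip_nth[of ws w i] d len lw that by simp
    have "\<beta> \<in> ?V"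
      unfolding variants_def
    proof (intro CollectI conjI allI impI ballI)
      fix x assume x: "x \<in> ?Z"
      then obtain i where "i < m" "x = ws ! i" using len by (auto simp: in_set_conv_nth)
      then show "\<beta> x \<in> B" using x sw lw fresh by (auto simp: \<beta>_def)
    qed (auto simp: \<beta>_def)
    moreover have "map \<beta> ws = w"
    proof (rule nth_equalityI)
      fix i assume "i < length (map \<beta> ws)"
      then have i: "i < m" using len by simp
      show "map \<beta> ws ! i = w ! i"
      proof (cases "i \<in> set v")
        case True
        then obtain j where j: "j < length v" "i = v ! j" by (auto simp: in_set_conv_nth)
        have "w ! i = tuple_proj w v ! j" using j by (simp add: tuple_proj_def)
        then have "w ! i = \<alpha> (ys ! j)" using w(1) j assms(6) by simp
        then show ?thesis using i j col[OF j(1)] assms(6) len by (simp add: \<beta>_def)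
      next
        case False
        then have "ws ! i \<in> ?Z"
          using col_names_in_iff[OF assms(3,6,4) i] i len by (simp add: ws_def)
        then show ?thesis using i len fresh by (simp add: \<beta>_def)
      qed
    qed (simp add: len lw)
    ultimately show "w \<in> (\<lambda>\<beta>. map \<beta> ws) ` ?V" by blast
  qed
  have "(\<Sum>\<beta>\<in>?V. R (map \<beta> ws)) = sum R ((\<lambda>\<beta>. map \<beta> ws) ` ?V)"
    using sum.reindex[OF inj, of R] by simp
  \<comment> \<open>By \<open>proj\<close> a tuple of the image can be missing from
    \<open>?W\<close> only because \<open>R\<close> is 0 there.\<close>
  also have "\<dots> = sum R ?W"
    by (rule sum.mono_neutral_right) (use W proj assms(2) in \<open>auto simp: finite_variants\<close>)
  finally show ?thesis by (simp add: kr_proj_def)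
qed

text \<open>The right-hand side does not mention \<open>B\<close>: this is the source of domain
  independence. For \<open>Proj\<close>, values from \<open>B\<close> outside the active domain add
  only zero terms.\<close>

lemma brc_val_calc_of:
  fixes I :: "('d, 'k::semiring_monus) db"
  assumes "is_database \<tau> I" "finite B" "adom I \<subseteq> B"
    and "bra_wf \<tau> E" "distinct ys" "length ys = bra_arity \<tau> E"
  shows "brc_val B I (calc_of \<tau> E ys) \<alpha> = bra_eval \<tau> I E (map \<alpha> ys)"
  using assms(4-6)
proof (induction E arbitrary: ys \<alpha>)
  case (Times E1 E2)
  then show ?case by (simp add: kr_times_def take_map drop_map)
next
  case (Proj v E)
  define ws where "ws = col_names v ys (bra_arity \<tau> E)"
  have v: "distinct v" "set v \<subseteq> {..<bra_arity \<tau> E}" "distinct ys" "length ys = length v"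
    using Proj.prems by auto
  have d: "distinct ws"
    using distinct_col_names v by (auto simp: ws_def)
  have IH: "brc_val B I (calc_of \<tau> E ws) \<beta> = bra_eval \<tau> I E (map \<beta> ws)" for \<beta>
    by (rule Proj.IH) (use Proj.prems d in \<open>auto simp: ws_def\<close>)
  have "krel_over (bra_arity \<tau> E) B (bra_eval \<tau> I E)"
    using krel_over_bra_eval[OF assms(1)] assms(3) Proj.prems by (fastforce simp: krel_over_def)
  from kr_proj_eq_sum_variants[OF this assms(2) v, of \<alpha>] show ?case
    using d assms(2) by (simp add: Let_def brc_val_foldr_FEx IH flip: ws_def)
next
  case (Sel \<theta> E)
  then show ?case by (simp add: brc_val_cond_formula kr_sel_def)
qed (simp_all add: kr_union_def kr_diff_def kr_supp_def)

lemma brc_rel_calc_of: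
  fixes I :: "('d, 'k::semiring_monus) db"
  assumes "is_database \<tau> I" "finite B" "B \<noteq> {}" "adom I \<subseteq> B"
    and "bra_wf \<tau> E" "bra_arity \<tau> E = n"
  shows "brc_rel B I (calc_of \<tau> E [0..<n]) [0..<n] = bra_eval \<tau> I E"
proof
  fix t
  show "brc_rel B I (calc_of \<tau> E [0..<n]) [0..<n] t = bra_eval \<tau> I E t"
  proof (cases "length t = n \<and> set t \<subseteq> B")
    case True
    \<comment> \<open>With the variables \<open>0, ..., n - 1\<close> as column names, the tuple
      itself, read as a function of positions, serves as the assignment.\<close>
    then have t: "map ((!) t) [0..<n] = t" by (metis map_nth)
    have "lists_fv [0..<n] (calc_of \<tau> E [0..<n])"
      using calc_of_wf[OF assms(5), of "[0..<n]"] assms(6) by (simp add: lists_fv_def)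
    then have "brc_rel B I (calc_of \<tau> E [0..<n]) [0..<n] t =
        brc_val B I (calc_of \<tau> E [0..<n]) ((!) t)"
      using t True assms(3) by (intro brc_rel_eq_brc_val) auto
    then show ?thesis
      using brc_val_calc_of[OF assms(1,2,4,5), of "[0..<n]"] t assms(6) by simp
  next
    case False
    then have "bra_eval \<tau> I E t = 0"
      using krel_over_bra_eval[OF assms(1,5)] assms(4,6) by (auto simp: krel_over_def)
    then show ?thesis using False by (auto simp: brc_rel_def)
  qed
qed

section \<open>From the calculus to the algebra\<close>

text \<open>The fold needs some unary expression to start from; \<open>Proj [0] (Sym 0)\<close> is
  well formed because a schema has a first symbol and its arity is positive. \<open>Supp\<close>
  erases the multiplicities.\<close>

definition adom_expr :: "nat list \<Rightarrow> bra" where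
  "adom_expr \<tau> = Supp (foldr Union
     (concat (map (\<lambda>i. map (\<lambda>j. Proj [j] (Sym i)) [0..<\<tau> ! i]) [0..<length \<tau>]))
     (Proj [0] (Sym 0)))"

lemma foldr_Union_wf:
  assumes "\<And>E. E \<in> insert E0 (set Es) \<Longrightarrow> bra_wf \<tau> E \<and> bra_arity \<tau> E = k"
  shows "bra_wf \<tau> (foldr Union Es E0) \<and> bra_arity \<tau> (foldr Union Es E0) = k"
  using assms by (induction Es) auto

text \<open>Zero-sum-freeness enters here: values cannot cancel, so the union detects an element as
  soon as one of its parts does.\<close>

lemma bra_eval_foldr_Union_eq_0:
  "bra_eval \<tau> I (foldr Union Es E0) t = 0 \<longleftrightarrow> (\<forall>E \<in> insert E0 (set Es). bra_eval \<tau> I E t = 0)"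
  by (induction Es) (auto simp: kr_union_def)

lemma adom_expr_wf:
  assumes "is_schema \<tau>"
  shows "bra_wf \<tau> (adom_expr \<tau>)" "bra_arity \<tau> (adom_expr \<tau>) = 1"
proof -
  have "0 < length \<tau>" "0 < \<tau> ! 0" using assms by (auto simp: is_schema_def)
  then have "bra_wf \<tau> (adom_expr \<tau>) \<and> bra_arity \<tau> (adom_expr \<tau>) = 1"
    unfolding adom_expr_def bra_wf.simps bra_arity.simps by (intro foldr_Union_wf) auto
  then show "bra_wf \<tau> (adom_expr \<tau>)" "bra_arity \<tau> (adom_expr \<tau>) = 1" by simp_all
qed

text \<open>Again nothing cancels. Finiteness excludes the default value 0 of sums over infinite
  sets.\<close>

lemma kr_proj_eq_0_iff:
  fixes R :: "('d, 'k::semiring_monus) krel"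
  assumes "finite {w. R w \<noteq> 0}"
  shows "kr_proj v R t = 0 \<longleftrightarrow> (\<forall>w. tuple_proj w v = t \<longrightarrow> R w = 0)"
  using assms by (auto simp: kr_proj_def)

lemma bra_eval_adom_expr:
  fixes I :: "('d, 'k::semiring_monus) db"
  assumes "is_schema \<tau>" "is_database \<tau> I"
  shows "bra_eval \<tau> I (adom_expr \<tau>) [a] = (if a \<in> adom I then 1 else 0)"
proof (cases "a \<in> adom I")
  case False
  then show ?thesis
    using krel_over_bra_eval[OF assms(2) adom_expr_wf(1)[OF assms(1)]]
    by (force simp: krel_over_def)
next
  case True
  have len: "length I = length \<tau>" using assms(2) by (simp add: is_database_def)
  obtain i t where i: "i < length \<tau>" "(I ! i) t \<noteq> 0" "a \<in> set t"
  proof -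
    obtain R t where "R \<in> set I" "R t \<noteq> 0" "a \<in> set t" using True by (auto simp: adom_def supp_def)
    then show thesis using that len by (auto simp: in_set_conv_nth[of R])
  qed
  have k: "krel_over (\<tau> ! i) (adom I) (I ! i)" by (rule krel_over_database[OF assms(2) i(1)])
  then have "length t = \<tau> ! i" using i by (auto simp: krel_over_def)
  then obtain j where j: "j < \<tau> ! i" "t ! j = a" using i(3) by (auto simp: in_set_conv_nth)
  have "finite {w. (I ! i) w \<noteq> 0}" by (rule finite_krel_over[OF k finite_adom[OF assms(2)]])
  then have "kr_proj [j] (I ! i) [a] \<noteq> 0"
    using i j by (auto simp: kr_proj_eq_0_iff tuple_proj_def)
  then have "\<not> (\<forall>E \<in> insert (Proj [0] (Sym 0)) (set (concat
      (map (\<lambda>i. map (\<lambda>j. Proj [j] (Sym i)) [0..<\<tau> ! i]) [0..<length \<tau>]))). bra_eval \<tau> I E [a] = 0)"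
    using i j by force
  then show ?thesis
    using True unfolding adom_expr_def bra_eval.simps kr_supp_def support_op_def
      bra_eval_foldr_Union_eq_0 by simp
qed

text \<open>Arity 0 needs a constant 1 on the empty tuple: projecting the active domain to no
  columns gives a nonzero value, since the domain is non-empty, and \<open>Supp\<close> normalises
  it.\<close>

primrec adom_power :: "nat list \<Rightarrow> nat \<Rightarrow> bra" where
  "adom_power \<tau> 0 = Supp (Proj [] (adom_expr \<tau>))"
| "adom_power \<tau> (Suc k) = Times (adom_expr \<tau>) (adom_power \<tau> k)"

lemma adom_power_wf:
  assumes "is_schema \<tau>"
  shows "bra_wf \<tau> (adom_power \<tau> k)" "bra_arity \<tau> (adom_power \<tau> k) = k"
  using adom_expr_wf[OF assms] by (induction k) auto

lemma bra_eval_adom_power: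
  fixes I :: "('d, 'k::semiring_monus) db"
  assumes "is_schema \<tau>" "is_database \<tau> I" "length t = k" "set t \<subseteq> adom I"
  shows "bra_eval \<tau> I (adom_power \<tau> k) t = 1"
  using assms(3,4)
proof (induction k arbitrary: t)
  case 0
  obtain a where a: "a \<in> adom I" using adom_nonempty[OF assms(1,2)] by auto
  have "finite {w. bra_eval \<tau> I (adom_expr \<tau>) w \<noteq> 0}"
    using krel_over_bra_eval[OF assms(2) adom_expr_wf(1)[OF assms(1)]] finite_adom[OF assms(2)]
    by (rule finite_krel_over)
  moreover have "bra_eval \<tau> I (adom_expr \<tau>) [a] \<noteq> 0" using a bra_eval_adom_expr[OF assms(1,2)] by simp
  ultimately have "kr_proj [] (bra_eval \<tau> I (adom_expr \<tau>)) [] \<noteq> 0"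
    by (auto simp: kr_proj_eq_0_iff tuple_proj_def)
  then show ?case using 0 by (simp add: kr_supp_def support_op_def)
next
  case (Suc k)
  then obtain a s where "t = a # s" by (cases t) auto
  then show ?case using Suc bra_eval_adom_expr[OF assms(1,2), of a] adom_expr_wf[OF assms(1)]
    by (simp add: kr_times_def)
qed

section \<open>Equijoins\<close>

text \<open>Column \<open>j\<close> of \<open>E1\<close> is matched with column
  \<open>ps ! j\<close> of \<open>E2\<close>, which the product shifts by \<open>m\<close>; only the
  columns of \<open>E2\<close> are kept. Entries of \<open>ps\<close> may repeat, as variables in an
  atom may.\<close>

definition join :: "nat list \<Rightarrow> bra \<Rightarrow> nat list \<Rightarrow> bra \<Rightarrow> bra" where
  "join \<tau> E1 ps E2 =
     (let m = bra_arity \<tau> E1; k = bra_arity \<tau> E2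
      in Proj [m..<m + k]
           (foldr (\<lambda>j. Sel (SEq j (m + ps ! j))) [0..<m] (Times E1 E2)))"

lemma foldr_Sel_arity [simp]: "bra_arity \<tau> (foldr (\<lambda>j. Sel (g j)) js E) = bra_arity \<tau> E"
  by (induction js) auto

lemma foldr_Sel_wf:
  assumes "bra_wf \<tau> E" "\<And>j. j \<in> set js \<Longrightarrow> selcond_wf (bra_arity \<tau> E) (g j)"
  shows "bra_wf \<tau> (foldr (\<lambda>j. Sel (g j)) js E)"
  using assms by (induction js) auto

lemma bra_eval_foldr_Sel:
  "bra_eval \<tau> I (foldr (\<lambda>j. Sel (g j)) js E) t =
    (if \<forall>j\<in>set js. selcond_sat (g j) t then bra_eval \<tau> I E t else 0)"
  by (induction js) (auto simp: kr_sel_def)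

lemma join_wf:
  assumes "bra_wf \<tau> E1" "bra_wf \<tau> E2" "length ps = bra_arity \<tau> E1" "set ps \<subseteq> {..<bra_arity \<tau> E2}"
  shows "bra_wf \<tau> (join \<tau> E1 ps E2)" "bra_arity \<tau> (join \<tau> E1 ps E2) = bra_arity \<tau> E2"
proof -
  have "ps ! j < bra_arity \<tau> E2" if "j < bra_arity \<tau> E1" for j
    using assms(3) subsetD[OF assms(4) nth_mem] that by simp
  then show "bra_wf \<tau> (join \<tau> E1 ps E2)" "bra_arity \<tau> (join \<tau> E1 ps E2) = bra_arity \<tau> E2"
    using assms by (auto simp: join_def Let_def intro!: foldr_Sel_wf)
qed

text \<open>The equalities determine the first columns from the kept ones, so the projection sums at
  most one term and leaves multiplicities unchanged.\<close>

lemma bra_eval_join: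
  fixes I :: "('d, 'k::semiring_monus) db"
  assumes "is_database \<tau> I" "bra_wf \<tau> E1" "bra_wf \<tau> E2"
    and "length ps = bra_arity \<tau> E1" "set ps \<subseteq> {..<bra_arity \<tau> E2}" "length t = bra_arity \<tau> E2"
  shows "bra_eval \<tau> I (join \<tau> E1 ps E2) t = bra_eval \<tau> I E1 (tuple_proj t ps) * bra_eval \<tau> I E2 t"
proof -
  let ?m = "bra_arity \<tau> E1" and ?k = "bra_arity \<tau> E2"
  let ?F = "foldr (\<lambda>j. Sel (SEq j (?m + ps ! j))) [0..<?m] (Times E1 E2)"
  let ?R = "bra_eval \<tau> I ?F"
  let ?u = "tuple_proj t ps"
  have ps: "ps ! j < ?k" if "j < ?m" for j
    using assms(4) subsetD[OF assms(5) nth_mem] that by simp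
  have lu: "length ?u = ?m" using assms(4) by (simp add: tuple_proj_def)
  have unique: "w = ?u @ t" if w: "tuple_proj w [?m..<?m + ?k] = t" "?R w \<noteq> 0" for w
  proof -
    have R: "bra_eval \<tau> I (Times E1 E2) w \<noteq> 0" "\<forall>j<?m. w ! j = w ! (?m + ps ! j)"
      using w(2) by (auto simp: bra_eval_foldr_Sel split: if_splits)
    have "length w = bra_arity \<tau> (Times E1 E2)"
      by (rule krel_overD(1)[OF krel_over_bra_eval R(1)]) (use assms in auto)
    then have lw: "length w = ?m + ?k" by simp
    have nth: "w ! (?m + i) = t ! i" if "i < ?k" for i
      using that arg_cong[OF w(1), of "\<lambda>s. s ! i"] by (simp add: tuple_proj_def)
    show ?thesis
    proof (rule nth_equalityI)
      fix i assume i: "i < length w"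
      show "w ! i = (?u @ t) ! i"
      proof (cases "i < ?m")
        case True
        then have "w ! i = t ! (ps ! i)" using R(2) nth[OF ps[OF True]] by simp
        then show ?thesis using True lu assms(4) by (simp add: nth_append tuple_proj_def)
      next
        case False
        then show ?thesis using i lw lu nth[of "i - ?m"] by (simp add: nth_append)
      qed
    qed (simp add: lw lu assms(6))
  qed
  have proj: "tuple_proj (?u @ t) [?m..<?m + ?k] = t"
    by (rule nth_equalityI) (auto simp: tuple_proj_def nth_append assms(4,6))
  have val: "?R (?u @ t) = bra_eval \<tau> I E1 ?u * bra_eval \<tau> I E2 t"
    using lu ps by (auto simp: bra_eval_foldr_Sel kr_times_def nth_append tuple_proj_def assms(4))
  have "tuple_proj w [?m..<?m + ?k] = t \<and> ?R w \<noteq> 0 \<longleftrightarrow> w = ?u @ t \<and> ?R (?u @ t) \<noteq> 0" for w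
    using unique[of w] proj by metis
  then have "{w. tuple_proj w [?m..<?m + ?k] = t \<and> ?R w \<noteq> 0} =
      (if ?R (?u @ t) = 0 then {} else {?u @ t})"
    by auto
  then have "kr_proj [?m..<?m + ?k] ?R t = ?R (?u @ t)" by (auto simp: kr_proj_def)
  then show ?thesis using val by (simp add: join_def Let_def)
qed

section \<open>The translation of formulas\<close>

text \<open>Both arguments of a connective share the arity \<open>k\<close>, so \<open>Union\<close>
  and \<open>Diff\<close> apply even when the free variables differ. A quantified variable moves to
  the new last column \<open>k\<close>; if it had a column before, that column is left unread in its
  scope.\<close>

primrec alg_of :: "nat list \<Rightarrow> brc \<Rightarrow> nat \<Rightarrow> (nat \<Rightarrow> nat) \<Rightarrow> bra" where
  "alg_of \<tau> (FEq x y) k f = Sel (SEq (f x) (f y)) (adom_power \<tau> k)"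
| "alg_of \<tau> (FSym i zs) k f = join \<tau> (Sym i) (map f zs) (adom_power \<tau> k)"
| "alg_of \<tau> (FAnd \<phi> \<psi>) k f = join \<tau> (alg_of \<tau> \<phi> k f) [0..<k] (alg_of \<tau> \<psi> k f)"
| "alg_of \<tau> (FOr \<phi> \<psi>) k f = Union (alg_of \<tau> \<phi> k f) (alg_of \<tau> \<psi> k f)"
| "alg_of \<tau> (FButnot \<phi> \<psi>) k f = Diff (alg_of \<tau> \<phi> k f) (alg_of \<tau> \<psi> k f)"
| "alg_of \<tau> (FNabla \<phi>) k f = Supp (alg_of \<tau> \<phi> k f)"
| "alg_of \<tau> (FEx x \<phi>) k f = Proj [0..<k] (alg_of \<tau> \<phi> (Suc k) (f(x := k)))"

lemma alg_of_wf:
  assumes "is_schema \<tau>" "brc_wf \<tau> \<phi>" "f ` fv \<phi> \<subseteq> {..<k}"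
  shows "bra_wf \<tau> (alg_of \<tau> \<phi> k f) \<and> bra_arity \<tau> (alg_of \<tau> \<phi> k f) = k"
  using assms(2,3)
proof (induction \<phi> arbitrary: k f)
  case (FEx x \<phi>)
  have "bra_wf \<tau> (alg_of \<tau> \<phi> (Suc k) (f(x := k))) \<and>
      bra_arity \<tau> (alg_of \<tau> \<phi> (Suc k) (f(x := k))) = Suc k"
    by (rule FEx.IH) (use FEx.prems in \<open>auto simp: less_Suc_eq\<close>)
  then show ?case by auto
next
  case (FAnd \<phi> \<psi>)
  then have "bra_wf \<tau> (alg_of \<tau> \<phi> k f) \<and> bra_arity \<tau> (alg_of \<tau> \<phi> k f) = k"
    "bra_wf \<tau> (alg_of \<tau> \<psi> k f) \<and> bra_arity \<tau> (alg_of \<tau> \<psi> k f) = k"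
    by (simp_all add: image_Un)
  then show ?case using join_wf[of \<tau> "alg_of \<tau> \<phi> k f" "alg_of \<tau> \<psi> k f" "[0..<k]"]
    by (auto simp: atLeast0LessThan)
next
  case (FSym i zs)
  then show ?case
    using join_wf[of \<tau> "Sym i" "adom_power \<tau> k" "map f zs"] by (simp add: adom_power_wf assms(1))
qed (auto simp: image_Un adom_power_wf assms(1))

text \<open>The tuples that project to \<open>t\<close> in the quantifier case are the
  \<open>t @ [b]\<close>, one for each value of the bound variable, so no column is counted twice.
  Restricting \<open>t\<close> to the active domain makes \<open>adom_power\<close> equal to 1 on
  it.\<close>

lemma bra_eval_alg_of:
  fixes I :: "('d, 'k::semiring_monus) db"
  assumes "is_schema \<tau>" "is_database \<tau> I"
    and "brc_wf \<tau> \<phi>" "f ` fv \<phi> \<subseteq> {..<k}"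
    and "length t = k" "set t \<subseteq> adom I" "\<And>x. x \<in> fv \<phi> \<Longrightarrow> \<alpha> x = t ! f x"
  shows "bra_eval \<tau> I (alg_of \<tau> \<phi> k f) t = brc_val (adom I) I \<phi> \<alpha>"
  using assms(3-7)
proof (induction \<phi> arbitrary: k f t \<alpha>)
  case (FEq x y)
  then show ?case by (simp add: kr_sel_def bra_eval_adom_power[OF assms(1,2)])
next
  case (FSym i zs)
  have "tuple_proj t (map f zs) = map \<alpha> zs" using FSym.prems by (simp add: tuple_proj_def)
  then show ?case
    using FSym.prems bra_eval_join[OF assms(2), of "Sym i" "adom_power \<tau> k" "map f zs" t]
    by (simp add: adom_power_wf[OF assms(1)] bra_eval_adom_power[OF assms(1,2)])
next
  case (FAnd \<phi> \<psi>)
  have IH: "bra_eval \<tau> I (alg_of \<tau> \<phi> k f) t = brc_val (adom I) I \<phi> \<alpha>"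
    "bra_eval \<tau> I (alg_of \<tau> \<psi> k f) t = brc_val (adom I) I \<psi> \<alpha>"
    using FAnd.prems by (auto intro!: FAnd.IH)
  have wf: "bra_wf \<tau> (alg_of \<tau> \<phi> k f) \<and> bra_arity \<tau> (alg_of \<tau> \<phi> k f) = k"
    "bra_wf \<tau> (alg_of \<tau> \<psi> k f) \<and> bra_arity \<tau> (alg_of \<tau> \<psi> k f) = k"
    using FAnd.prems alg_of_wf[OF assms(1)] by (simp_all add: image_Un)
  have "tuple_proj t [0..<k] = t" using FAnd.prems(3) by (metis map_nth tuple_proj_def)
  then show ?case
    using bra_eval_join[OF assms(2), of "alg_of \<tau> \<phi> k f" "alg_of \<tau> \<psi> k f" "[0..<k]" t]
      IH wf FAnd.prems(3) by (simp add: atLeast0LessThan)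
next
  case (FOr \<phi> \<psi>)
  have "bra_eval \<tau> I (alg_of \<tau> \<phi> k f) t = brc_val (adom I) I \<phi> \<alpha>"
    "bra_eval \<tau> I (alg_of \<tau> \<psi> k f) t = brc_val (adom I) I \<psi> \<alpha>"
    using FOr.prems by (auto intro!: FOr.IH)
  then show ?case by (simp add: kr_union_def)
next
  case (FButnot \<phi> \<psi>)
  have "bra_eval \<tau> I (alg_of \<tau> \<phi> k f) t = brc_val (adom I) I \<phi> \<alpha>"
    "bra_eval \<tau> I (alg_of \<tau> \<psi> k f) t = brc_val (adom I) I \<psi> \<alpha>"
    using FButnot.prems by (auto intro!: FButnot.IH)
  then show ?case by (simp add: kr_diff_def)
next
  case (FNabla \<phi>)
  have "bra_eval \<tau> I (alg_of \<tau> \<phi> k f) t = brc_val (adom I) I \<phi> \<alpha>"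
    using FNabla.prems by (auto intro!: FNabla.IH)
  then show ?case by (simp add: kr_supp_def)
next
  case (FEx x \<phi>)
  let ?E = "alg_of \<tau> \<phi> (Suc k) (f(x := k))"
  let ?R = "bra_eval \<tau> I ?E"
  let ?W = "{w. tuple_proj w [0..<k] = t \<and> ?R w \<noteq> 0}"
  have f: "(f(x := k)) ` fv \<phi> \<subseteq> {..<Suc k}" "brc_wf \<tau> \<phi>"
    using FEx.prems by (auto simp: less_Suc_eq)
  have wf: "bra_wf \<tau> ?E" "bra_arity \<tau> ?E = Suc k" using alg_of_wf[OF assms(1) f(2,1)] by auto
  \<comment> \<open>Position \<open>k\<close> of \<open>t @ [b]\<close> holds \<open>b\<close>, and
    the columns of the other free variables lie below \<open>k\<close>.\<close>
  have IH: "?R (t @ [b]) = brc_val (adom I) I \<phi> (\<alpha>(x := b))" if "b \<in> adom I" for b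
  proof (rule FEx.IH[OF f(2,1)])
    fix y assume "y \<in> fv \<phi>"
    then show "(\<alpha>(x := b)) y = (t @ [b]) ! (f(x := k)) y"
      using FEx.prems(2,3) FEx.prems(5)[of y] by (auto simp: nth_append)
  qed (use FEx.prems that in auto)
  have R: "krel_over (Suc k) (adom I) ?R" using krel_over_bra_eval[OF assms(2) wf(1)] wf(2) by simp
  have W: "?W \<subseteq> (\<lambda>b. t @ [b]) ` adom I"
  proof
    fix w assume "w \<in> ?W"
    then have w: "tuple_proj w [0..<k] = t" "length w = Suc k" "set w \<subseteq> adom I"
      using krel_overD[OF R] by auto
    then obtain s b where sb: "w = s @ [b]" "length s = k"
      by (metis length_Suc_conv_rev)
    have "tuple_proj w [0..<k] = s"
      using sb by (auto simp: tuple_proj_def nth_append intro!: nth_equalityI)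
    then show "w \<in> (\<lambda>b. t @ [b]) ` adom I" using w sb by auto
  qed
  have proj: "tuple_proj (t @ [b]) [0..<k] = t" for b
    using FEx.prems(3) by (auto simp: tuple_proj_def nth_append intro!: nth_equalityI)
  have "sum ?R ?W = sum ?R ((\<lambda>b. t @ [b]) ` adom I)"
    \<comment> \<open>The tuples \<open>t @ [b]\<close> outside \<open>?W\<close> have value
      0.\<close>
    by (rule sum.mono_neutral_left) (use W proj finite_adom[OF assms(2)] in auto)
  also have "\<dots> = (\<Sum>b\<in>adom I. ?R (t @ [b]))"
    by (subst sum.reindex) (auto simp: inj_on_def)
  also have "\<dots> = (\<Sum>b\<in>adom I. brc_val (adom I) I \<phi> (\<alpha>(x := b)))"
    by (rule sum.cong) (use IH in auto)
  finally show ?case by (simp add: kr_proj_def)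
qed

lemma lists_fv_position:
  assumes "lists_fv ys \<phi>" "\<And>j. j < length ys \<Longrightarrow> f (ys ! j) = j" "x \<in> fv \<phi>"
  shows "f x < length ys" "ys ! f x = x"
proof -
  have "x \<in> set ys" using assms(1,3) by (simp add: lists_fv_def)
  then obtain j where "j < length ys" "x = ys ! j" by (auto simp: in_set_conv_nth)
  then show "f x < length ys" "ys ! f x = x" using assms(2) by simp_all
qed

lemma bra_eval_alg_of_eq_brc_rel:
  fixes I :: "('d, 'k::semiring_monus) db"
  assumes "is_schema \<tau>" "is_database \<tau> I" "brc_wf \<tau> \<phi>" "lists_fv ys \<phi>"
    and "\<And>j. j < length ys \<Longrightarrow> f (ys ! j) = j"
  shows "bra_eval \<tau> I (alg_of \<tau> \<phi> (length ys) f) = brc_rel (adom I) I \<phi> ys"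
proof
  fix t
  have fv: "f ` fv \<phi> \<subseteq> {..<length ys}" "x \<in> fv \<phi> \<Longrightarrow> ys ! f x = x" for x
    using lists_fv_position[OF assms(4,5)] by auto
  note wf = alg_of_wf[OF assms(1,3) fv(1)]
  show "bra_eval \<tau> I (alg_of \<tau> \<phi> (length ys) f) t = brc_rel (adom I) I \<phi> ys t"
  proof (cases "length t = length ys \<and> set t \<subseteq> adom I")
    case True
    define \<alpha> where "\<alpha> x = t ! f x" for x
    have "map \<alpha> ys = t" using True assms(5) by (auto simp: \<alpha>_def intro!: nth_equalityI)
    then have "brc_rel (adom I) I \<phi> ys t = brc_val (adom I) I \<phi> \<alpha>"
      using True assms(4) adom_nonempty[OF assms(1,2)] by (intro brc_rel_eq_brc_val) auto
    moreover have "bra_eval \<tau> I (alg_of \<tau> \<phi> (length ys) f) t = brc_val (adom I) I \<phi> \<alpha>"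
      by (rule bra_eval_alg_of[OF assms(1-3) fv(1)]) (use True in \<open>auto simp: \<alpha>_def\<close>)
    ultimately show ?thesis by simp
  next
    case False
    then have "bra_eval \<tau> I (alg_of \<tau> \<phi> (length ys) f) t = 0"
      using krel_over_bra_eval[OF assms(2), of "alg_of \<tau> \<phi> (length ys) f"] wf
      by (auto simp: krel_over_def)
    then show ?thesis using False by (auto simp: brc_rel_def)
  qed
qed

section \<open>The equivalence\<close>

theorem theorem1:
  fixes \<tau> :: "nat list" and n :: nat
    and q :: "('d, 'k::semiring_monus) db \<Rightarrow> ('d, 'k) krel"
  assumes denumerable: "countable (UNIV :: 'd set)" "infinite (UNIV :: 'd set)"
    and zero_sum_free: "\<And>a b :: 'k. a + b = 0 \<Longrightarrow> a = 0 \<and> b = 0"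
    and schema: "is_schema \<tau>"
    and query: "is_query \<tau> n q"
  shows
    "((\<exists>E. bra_wf \<tau> E \<and> bra_arity \<tau> E = n \<and>
        (\<forall>I. is_database \<tau> I \<longrightarrow> q I = bra_eval \<tau> I E))
      \<longleftrightarrow>
      (\<exists>\<phi> ys. brc_wf \<tau> \<phi> \<and> lists_fv ys \<phi> \<and> length ys = n \<and>
        domain_independent TYPE('d) TYPE('k) \<tau> \<phi> ys \<and>
        (\<forall>I. is_database \<tau> I \<longrightarrow> q I = brc_rel (adom I) I \<phi> ys)))
     \<and>
     ((\<exists>\<phi> ys. brc_wf \<tau> \<phi> \<and> lists_fv ys \<phi> \<and> length ys = n \<and>
        domain_independent TYPE('d) TYPE('k) \<tau> \<phi> ys \<and>
        (\<forall>I. is_database \<tau> I \<longrightarrow> q I = brc_rel (adom I) I \<phi> ys))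
      \<longleftrightarrow>
      (\<exists>\<phi> ys. brc_wf \<tau> \<phi> \<and> lists_fv ys \<phi> \<and> length ys = n \<and>
        (\<forall>I. is_database \<tau> I \<longrightarrow> q I = brc_rel (adom I) I \<phi> ys)))"
proof -
  have alg_to_calc: "\<exists>\<phi> ys. brc_wf \<tau> \<phi> \<and> lists_fv ys \<phi> \<and> length ys = n \<and>
        domain_independent TYPE('d) TYPE('k) \<tau> \<phi> ys \<and>
        (\<forall>I. is_database \<tau> I \<longrightarrow> q I = brc_rel (adom I) I \<phi> ys)"
    if E: "bra_wf \<tau> E" "bra_arity \<tau> E = n"
      and q: "\<forall>I. is_database \<tau> I \<longrightarrow> q I = bra_eval \<tau> I E" for E
  proof (intro exI conjI)
    let ?\<phi> = "calc_of \<tau> E [0..<n]"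
    \<comment> \<open>One equation for all finite \<open>B\<close> above the active domain yields
      both domain independence and agreement with \<open>q\<close>.\<close>
    have rel: "brc_rel B I ?\<phi> [0..<n] = bra_eval \<tau> I E"
      if "is_database \<tau> I" "finite B" "adom I \<subseteq> B" for B and I :: "('d, 'k) db"
      using brc_rel_calc_of[OF that(1,2) _ that(3) E] adom_nonempty[OF schema that(1)] that(3)
      by auto
    show "brc_wf \<tau> ?\<phi>" "lists_fv [0..<n] ?\<phi>"
      using calc_of_wf[OF E(1), of "[0..<n]"] E(2) by (simp_all add: lists_fv_def)
    show "domain_independent TYPE('d) TYPE('k) \<tau> ?\<phi> [0..<n]"
      unfolding domain_independent_def
      by (auto simp: rel finite_adom is_structure_def)
    show "\<forall>I. is_database \<tau> I \<longrightarrow> q I = brc_rel (adom I) I ?\<phi> [0..<n]"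
      by (auto simp: rel finite_adom q)
  qed simp
  have calc_to_alg: "\<exists>E. bra_wf \<tau> E \<and> bra_arity \<tau> E = n \<and>
        (\<forall>I. is_database \<tau> I \<longrightarrow> q I = bra_eval \<tau> I E)"
    if \<phi>: "brc_wf \<tau> \<phi>" "lists_fv ys \<phi>" "length ys = n"
      and q: "\<forall>I. is_database \<tau> I \<longrightarrow> q I = brc_rel (adom I) I \<phi> ys" for \<phi> ys
  proof (intro exI conjI)
    \<comment> \<open>\<open>f\<close> sends each free variable to its position in
      \<open>ys\<close>; elsewhere its values do not matter.\<close>
    define f where "f = the_inv_into {..<n} ((!) ys)"
    have f: "f (ys ! j) = j" if "j < length ys" for j
      unfolding f_def using that \<phi>(2,3)
      by (intro the_inv_into_f_f) (auto simp: lists_fv_def intro: inj_on_nth)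
    have "f ` fv \<phi> \<subseteq> {..<n}"
      using lists_fv_position(1)[OF \<phi>(2) f] \<phi>(3) by auto
    then show "bra_wf \<tau> (alg_of \<tau> \<phi> n f)" "bra_arity \<tau> (alg_of \<tau> \<phi> n f) = n"
      using alg_of_wf[OF schema \<phi>(1)] by auto
    show "\<forall>I. is_database \<tau> I \<longrightarrow> q I = bra_eval \<tau> I (alg_of \<tau> \<phi> n f)"
    proof (intro allI impI)
      fix I :: "('d, 'k) db" assume I: "is_database \<tau> I"
      then show "q I = bra_eval \<tau> I (alg_of \<tau> \<phi> n f)"
        using bra_eval_alg_of_eq_brc_rel[OF schema I \<phi>(1,2) f] \<phi>(3) q by simp
    qed
  qed
  \<comment> \<open>Statement 2 gives 3 by forgetting domain independence; 3 leads back to 2 through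
    the algebra, since \<open>calc_to_alg\<close> works for any formula.\<close>
  show ?thesis
    using alg_to_calc calc_to_alg by blast
qed

end
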